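(* Let $q$ be a prime power and $v=\sqrt{q}$. Let $A$ be the (associative unital) $\mathbb{Q}(v)$-algebra with generators $x_i$ and $y_i$, $i\in\mathbb{Z}$, subject to the following relations, for all $i,j\in\mathbb{Z}$: \begin{align*} &x_i^2x_{i-1}-(1+q^{-1})x_ix_{i-1}x_i+q^{-1}x_{i-1}x_i^2=0,\\ &x_ix_{i-1}^2-(1+q^{-1})x_{i-1}x_ix_{i-1}+q^{-1}x_{i-1}^2x_i=0,\\ &x_ix_j-x_jx_i=0\quad\text{if }|i-j|>1,\\ &y_ix_i-q\,x_iy_i+\tfrac{q}{q-1}=0,\\ &y_ix_{i+1}-q^{-1}x_{i+1}y_i-\tfrac{1}{q-1}=0,\\ &y_ix_j-x_jy_i=0\quad\text{if }j\neq i,i+1,\\ &y_i^2y_{i-1}-(1+q^{-1})y_iy_{i-1}y_i+q^{-1}y_{i-1}y_i^2=0,\\ &y_iy_{i-1}^2-(1+q^{-1})y_{i-1}y_iy_{i-1}+q^{-1}y_{i-1}^2y_i=0,\\ &y_iy_j-y_jy_i=0\quad\text{if }|i-j|>1. \end{align*} Let $I$ be the two-sided ideal of $A$ generated by the space $[A,A]$ of commutators of $A$. Then the assignment $$\varphi:\ x_i\mapsto\frac{v}{v^2-1}\,x,\qquad y_i\mapsto\frac{v}{v^2-1}\,x^{-1}\qquad(i\in\mathbb{Z})$$ defines an algebra homomorphism from $A$ to $\mathbb{Q}(v)[x,x^{-1}]$ with kernel $I$.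
   Context: $\mathbb{Q}(v)[x,x^{-1}]$ is the algebra of Laurent polynomials in one variable $x$ over the field $\mathbb{Q}(v)$, where $v=\sqrt q$. *)

theory Defs
  imports
    "HOL-Algebra.Algebra"
    "HOL-Algebra.Algebraic_Closure_Type"
    "HOL-Library.Poly_Mapping"
    "HOL-Number_Theory.Prime_Powers"
begin

section \<open>The field obtained by adjoining a real number to the rationals\<close>

definition rat_adjoin :: "real \<Rightarrow> real ring" where
  "rat_adjoin v = ring_of_type_algebra\<lparr>carrier := generate_field ring_of_type_algebra {v}\<rparr>"


section \<open>Associative algebras, not necessarily commutative\<close>

text \<open>The library locale \<^locale>\<open>algebra\<close> requires commutativity, so algebras are
  represented here by the bare records with scalar multiplication.\<close>

definition alg_hom ::
  "('k, 'c) ring_scheme \<Rightarrow> ('k, 'a, 'd) module_scheme \<Rightarrow> ('k, 'b, 'e) module_scheme \<Rightarrow> ('a \<Rightarrow> 'b) set"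
where
  "alg_hom K A B =
     {h \<in> ring_hom A B.
        \<forall>c\<in>carrier K. \<forall>a\<in>carrier A. h (c \<odot>\<^bsub>A\<^esub> a) = c \<odot>\<^bsub>B\<^esub> h a}"

definition lin_span ::
  "('k, 'c) ring_scheme \<Rightarrow> ('k, 'a, 'd) module_scheme \<Rightarrow> 'a set \<Rightarrow> 'a set"
where
  "lin_span K A S = \<Inter>{N. submodule N K A \<and> S \<subseteq> N}"

definition commutator_space ::
  "('k, 'c) ring_scheme \<Rightarrow> ('k, 'a, 'd) module_scheme \<Rightarrow> 'a set"
where
  "commutator_space K A =
     lin_span K A {a \<otimes>\<^bsub>A\<^esub> b \<ominus>\<^bsub>A\<^esub> b \<otimes>\<^bsub>A\<^esub> a | a b. a \<in> carrier A \<and> b \<in> carrier A}"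


section \<open>Monoid algebras\<close>

definition scale :: "'k::field \<Rightarrow> ('m \<Rightarrow>\<^sub>0 'k) \<Rightarrow> ('m \<Rightarrow>\<^sub>0 'k)" where
  "scale c p = Poly_Mapping.map ((*) c) p"

text \<open>The monoid is written additively, since the product of \<^typ>\<open>'m \<Rightarrow>\<^sub>0 'k\<close> is the
  convolution along \<open>+\<close>. The coefficients are restricted to the subfield \<open>carrier K\<close> of the
  type \<^typ>\<open>'k\<close>, whose operations are those of the type.\<close>

definition monoid_algebra ::
  "'k::field ring \<Rightarrow> ('k, 'm::monoid_add \<Rightarrow>\<^sub>0 'k) module"
where
  "monoid_algebra K =
     \<lparr>carrier = {p. \<forall>m. Poly_Mapping.lookup p m \<in> carrier K},
      monoid.mult = (*), one = 1, ring.zero = 0, add = (+), module.smult = scale\<rparr>"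

text \<open>The Laurent polynomials are the monoid algebra of the integers under addition: the
  power \<open>x\<^sup>n\<close> is the basis element at the integer \<open>n\<close>.\<close>

definition laurent_algebra :: "'k::field ring \<Rightarrow> ('k, int \<Rightarrow>\<^sub>0 'k) module" where
  "laurent_algebra K = monoid_algebra K"

definition laurent_power :: "int \<Rightarrow> (int \<Rightarrow>\<^sub>0 'k::field)" where
  "laurent_power n = Poly_Mapping.single n 1"


section \<open>Free algebras and presentations\<close>

text \<open>Words under concatenation, again written additively.\<close>

datatype 'g word_monoid = Word (letters: "'g list")

instantiation word_monoid :: (type) monoid_add
begin

definition zero_word_monoid :: "'a word_monoid" where
  "0 = Word []"

definition plus_word_monoid :: "'a word_monoid \<Rightarrow> 'a word_monoid \<Rightarrow> 'a word_monoid" where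
  "u + w = Word (letters u @ letters w)"

instance
  by standard (simp_all add: zero_word_monoid_def plus_word_monoid_def)

end

definition free_algebra :: "'k::field ring \<Rightarrow> ('k, 'g word_monoid \<Rightarrow>\<^sub>0 'k) module" where
  "free_algebra K = monoid_algebra K"

definition free_gen :: "'g \<Rightarrow> ('g word_monoid \<Rightarrow>\<^sub>0 'k::field)" where
  "free_gen g = Poly_Mapping.single (Word [g]) 1"

text \<open>The ring \<open>F Quot J\<close> of the library has no scalar multiplication; it is added here, in
  the style of \<^const>\<open>rcoset_mult\<close>.\<close>

definition presented_algebra ::
  "'k::field ring \<Rightarrow> ('g word_monoid \<Rightarrow>\<^sub>0 'k) set \<Rightarrow> ('k, ('g word_monoid \<Rightarrow>\<^sub>0 'k) set) module"
where
  "presented_algebra K R =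
     (let F = free_algebra K; J = genideal F R in
      ring.extend (F Quot J)
        (module.fields (\<lambda>c C. \<Union>a\<in>C. J +>\<^bsub>F\<^esub> (c \<odot>\<^bsub>F\<^esub> a))))"

definition presented_gen ::
  "'k::field ring \<Rightarrow> ('g word_monoid \<Rightarrow>\<^sub>0 'k) set \<Rightarrow> 'g \<Rightarrow> ('g word_monoid \<Rightarrow>\<^sub>0 'k) set"
where
  "presented_gen K R g = genideal (free_algebra K) R +>\<^bsub>free_algebra K\<^esub> free_gen g"


section \<open>The algebra \<open>A\<close>\<close>

datatype xy_gen = GenX int | GenY int

abbreviation free_x :: "int \<Rightarrow> (xy_gen word_monoid \<Rightarrow>\<^sub>0 real)" where
  "free_x i \<equiv> free_gen (GenX i)"

abbreviation free_y :: "int \<Rightarrow> (xy_gen word_monoid \<Rightarrow>\<^sub>0 real)" where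
  "free_y i \<equiv> free_gen (GenY i)"

text \<open>Each set collects, for one defining relation, the left-hand sides of the relation
  (whose right-hand side is zero) over all admissible indices.\<close>

definition A_relations :: "real \<Rightarrow> (xy_gen word_monoid \<Rightarrow>\<^sub>0 real) set" where
  "A_relations q =
     {free_x i ^ 2 * free_x (i - 1)
        - scale (1 + inverse q) (free_x i * free_x (i - 1) * free_x i)
        + scale (inverse q) (free_x (i - 1) * free_x i ^ 2) | i. True}
   \<union> {free_x i * free_x (i - 1) ^ 2
        - scale (1 + inverse q) (free_x (i - 1) * free_x i * free_x (i - 1))
        + scale (inverse q) (free_x (i - 1) ^ 2 * free_x i) | i. True}
   \<union> {free_x i * free_x j - free_x j * free_x i | i j. \<bar>i - j\<bar> > 1}
   \<union> {free_y i * free_x i - scale q (free_x i * free_y i) + scale (q / (q - 1)) 1 | i. True}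
   \<union> {free_y i * free_x (i + 1) - scale (inverse q) (free_x (i + 1) * free_y i)
        - scale (1 / (q - 1)) 1 | i. True}
   \<union> {free_y i * free_x j - free_x j * free_y i | i j. j \<noteq> i \<and> j \<noteq> i + 1}
   \<union> {free_y i ^ 2 * free_y (i - 1)
        - scale (1 + inverse q) (free_y i * free_y (i - 1) * free_y i)
        + scale (inverse q) (free_y (i - 1) * free_y i ^ 2) | i. True}
   \<union> {free_y i * free_y (i - 1) ^ 2
        - scale (1 + inverse q) (free_y (i - 1) * free_y i * free_y (i - 1))
        + scale (inverse q) (free_y (i - 1) ^ 2 * free_y i) | i. True}
   \<union> {free_y i * free_y j - free_y j * free_y i | i j. \<bar>i - j\<bar> > 1}"

definition A_algebra :: "nat \<Rightarrow> (real, (xy_gen word_monoid \<Rightarrow>\<^sub>0 real) set) module" where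
  "A_algebra q = presented_algebra (rat_adjoin (sqrt (real q))) (A_relations (real q))"

definition A_x :: "nat \<Rightarrow> int \<Rightarrow> (xy_gen word_monoid \<Rightarrow>\<^sub>0 real) set" where
  "A_x q i = presented_gen (rat_adjoin (sqrt (real q))) (A_relations (real q)) (GenX i)"

definition A_y :: "nat \<Rightarrow> int \<Rightarrow> (xy_gen word_monoid \<Rightarrow>\<^sub>0 real) set" where
  "A_y q i = presented_gen (rat_adjoin (sqrt (real q))) (A_relations (real q)) (GenY i)"

end

theory Submission
  imports Defs
begin

text \<open>In any quotient of \<open>A\<close> where the generators commute, the mixed relations become
  \<open>x\<^sub>i y\<^sub>i = x\<^sub>i\<^sub>+\<^sub>1 y\<^sub>i = c\<^sup>2\<close> with \<open>c = v / (v\<^sup>2 - 1)\<close>. Since \<open>c\<close> is invertible, all \<open>x\<^sub>i\<close>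
  coincide, all \<open>y\<^sub>i\<close> coincide, and \<open>x\<^sub>0 / c\<close> and \<open>y\<^sub>0 / c\<close> are mutually inverse. Hence every
  element \<open>p\<close> of the free algebra is congruent to the image of \<open>\<phi>(p)\<close> under the linear map
  sending \<open>x\<^sup>n\<close> to the \<open>n\<close>-th power of \<open>x\<^sub>0 / c\<close>, so \<open>\<phi>(p) = 0\<close> forces \<open>p\<close> to vanish in the
  quotient. The reverse inclusion holds because Laurent polynomials commute.\<close>

section \<open>Linear maps between monoid algebras\<close>

lemma lookup_scale [simp]:
  "Poly_Mapping.lookup (scale c p) m = c * Poly_Mapping.lookup p m"
  by (simp add: scale_def Poly_Mapping.map.rep_eq when_def)

lemma scale_0_right [simp]: "scale c 0 = 0"
  by (rule poly_mapping_eqI) simp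

lemma scale_1_left [simp]: "scale 1 p = p"
  by (rule poly_mapping_eqI) simp

lemma scale_scale: "scale c (scale d p) = scale (c * d) p"
  by (rule poly_mapping_eqI) simp

lemma scale_add_right: "scale c (p + r) = scale c p + scale c r"
  by (rule poly_mapping_eqI) (simp add: lookup_add algebra_simps)

lemma scale_diff_right: "scale c (p - r) = scale c p - scale c r"
  by (rule poly_mapping_eqI) (simp add: lookup_minus algebra_simps)

lemma scale_add_left: "scale (c + d) p = scale c p + scale d p"
  by (rule poly_mapping_eqI) (simp add: lookup_add algebra_simps)

lemma scale_diff_left: "scale (c - d) p = scale c p - scale d p"
  by (rule poly_mapping_eqI) (simp add: lookup_minus algebra_simps)

lemma scale_single: "scale c (Poly_Mapping.single m d) = Poly_Mapping.single m (c * d)"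
  by (rule poly_mapping_eqI) (simp add: lookup_single when_def)

lemma poly_mapping_induct_on [consumes 1, case_names zero add]:
  fixes p :: "'m \<Rightarrow>\<^sub>0 'k::monoid_add"
  assumes coeffs: "\<And>m. Poly_Mapping.lookup p m \<in> S"
    and zero: "P 0"
    and add: "\<And>m c p. \<lbrakk>c \<in> S; \<And>m. Poly_Mapping.lookup p m \<in> insert 0 S; P p\<rbrakk>
      \<Longrightarrow> P (Poly_Mapping.single m c + p)"
  shows "P p"
proof -
  have "P p" if "finite A" "Poly_Mapping.keys p \<subseteq> A" "\<And>m. Poly_Mapping.lookup p m \<in> insert 0 S" for A p
    using that
  proof (induction A arbitrary: p rule: finite_induct)
    case empty
    then have "p = 0" by simp
    then show ?case using zero by simp
  next
    case (insert x A)
    show ?case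
    proof (cases "Poly_Mapping.lookup p x \<in> S")
      case False
      then have "x \<notin> Poly_Mapping.keys p"
        using insert.prems(2)[of x] by (auto simp: in_keys_iff)
      then show ?thesis using insert by blast
    next
      case True
      define r where "r = Poly_Mapping.update x 0 p"
      have look: "Poly_Mapping.lookup r m = (if m = x then 0 else Poly_Mapping.lookup p m)" for m
        by (simp add: r_def update.rep_eq)
      have "p = Poly_Mapping.single x (Poly_Mapping.lookup p x) + r"
        by (rule poly_mapping_eqI) (auto simp: lookup_add lookup_single look when_def)
      moreover have "P r"
      proof (rule insert.IH)
        show "Poly_Mapping.keys r \<subseteq> A"
          using insert.prems(1) by (auto simp: in_keys_iff look split: if_splits)
        show "Poly_Mapping.lookup r m \<in> insert 0 S" for m
          using insert.prems(2) by (simp add: look)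
      qed
      moreover have "Poly_Mapping.lookup r m \<in> insert 0 S" for m
        using insert.prems(2) by (simp add: look)
      ultimately show ?thesis
        using add[OF True] by metis
    qed
  qed
  from this[of "Poly_Mapping.keys p" p] coeffs show ?thesis by simp
qed

lemmas poly_mapping_induct =
  poly_mapping_induct_on[where S = UNIV, OF UNIV_I, simplified, case_names zero add]

lemma scale_mult_left: "scale c p * r = scale c (p * r)"
proof -
  have *: "scale c p = Poly_Mapping.single 0 c * p" for p :: "'a \<Rightarrow>\<^sub>0 'b"
    by (induction p rule: poly_mapping_induct)
      (simp_all add: scale_add_right scale_single distrib_left mult_single)
  show ?thesis by (simp add: * mult.assoc)
qed

lemma scale_mult_right: "p * scale c r = scale c (p * r)"
proof -
  have *: "scale c p = p * Poly_Mapping.single 0 c" for p :: "'a \<Rightarrow>\<^sub>0 'b"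
    by (induction p rule: poly_mapping_induct)
      (simp_all add: scale_add_right scale_single distrib_right mult_single mult.commute)
  show ?thesis by (simp add: * mult.assoc)
qed

definition linear_extension :: "('m \<Rightarrow> 'n \<Rightarrow>\<^sub>0 'k) \<Rightarrow> ('m \<Rightarrow>\<^sub>0 'k) \<Rightarrow> ('n \<Rightarrow>\<^sub>0 'k::field)" where
  "linear_extension g p = (\<Sum>m\<in>Poly_Mapping.keys p. scale (Poly_Mapping.lookup p m) (g m))"

lemma scale_0_left [simp]: "scale 0 p = 0"
  by (rule poly_mapping_eqI) simp

lemma linear_extension_superset:
  assumes "finite A" "Poly_Mapping.keys p \<subseteq> A"
  shows "linear_extension g p = (\<Sum>m\<in>A. scale (Poly_Mapping.lookup p m) (g m))"
  unfolding linear_extension_def using assms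
  by (intro sum.mono_neutral_left) (auto simp: in_keys_iff)

lemma linear_extension_0 [simp]: "linear_extension g 0 = 0"
  by (simp add: linear_extension_def)

lemma linear_extension_add:
  "linear_extension g (p + r) = linear_extension g p + linear_extension g r"
proof -
  let ?A = "Poly_Mapping.keys p \<union> Poly_Mapping.keys r"
  have *: "linear_extension g s = (\<Sum>m\<in>?A. scale (Poly_Mapping.lookup s m) (g m))"
    if "Poly_Mapping.keys s \<subseteq> ?A" for s
    using that by (simp add: linear_extension_superset)
  show ?thesis
    by (simp add: * Poly_Mapping.keys_add lookup_add scale_add_left sum.distrib)
qed

lemma linear_extension_single [simp]:
  "linear_extension g (Poly_Mapping.single m c) = scale c (g m)"
  by (simp add: linear_extension_def)

lemma linear_extension_scale:
  "linear_extension g (scale c p) = scale c (linear_extension g p)"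
  by (induction p rule: poly_mapping_induct)
    (simp_all add: scale_add_right scale_single scale_scale linear_extension_add)

lemma linear_extension_diff:
  "linear_extension g (p - r) = linear_extension g p - linear_extension g r"
  by (metis add_diff_cancel_right' diff_add_cancel linear_extension_add)

lemma linear_extension_mult:
  assumes "\<And>m n. g (m + n) = g m * g n"
  shows "linear_extension g (p * r) = linear_extension g p * linear_extension g r"
proof (induction p rule: poly_mapping_induct)
  case (add m c p)
  have "linear_extension g (Poly_Mapping.single m c * r) = scale c (g m) * linear_extension g r"
    by (induction r rule: poly_mapping_induct)
      (simp_all add: distrib_left linear_extension_add mult_single assms
        scale_mult_left scale_mult_right scale_scale mult.commute)
  with add show ?case
    by (simp add: distrib_right linear_extension_add)
qed simp

section \<open>Monoid algebras over a subfield\<close>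

locale subfield_of_type =
  fixes K :: "'k::field ring"
  assumes zero_mem [simp]: "0 \<in> carrier K"
    and one_mem [simp]: "1 \<in> carrier K"
    and add_mem [simp]: "\<lbrakk>a \<in> carrier K; b \<in> carrier K\<rbrakk> \<Longrightarrow> a + b \<in> carrier K"
    and uminus_mem [simp]: "a \<in> carrier K \<Longrightarrow> - a \<in> carrier K"
    and mult_mem [simp]: "\<lbrakk>a \<in> carrier K; b \<in> carrier K\<rbrakk> \<Longrightarrow> a * b \<in> carrier K"
    and inverse_mem [simp]: "a \<in> carrier K \<Longrightarrow> inverse a \<in> carrier K"
begin

lemma diff_mem [simp]: "\<lbrakk>a \<in> carrier K; b \<in> carrier K\<rbrakk> \<Longrightarrow> a - b \<in> carrier K"
  by (metis add_mem uminus_mem diff_conv_add_uminus)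

lemma divide_mem [simp]: "\<lbrakk>a \<in> carrier K; b \<in> carrier K\<rbrakk> \<Longrightarrow> a / b \<in> carrier K"
  by (simp add: divide_inverse)

lemma power_mem [simp]: "a \<in> carrier K \<Longrightarrow> a ^ n \<in> carrier K"
  by (induction n) simp_all

end

lemma subfield_of_type_rat_adjoin: "subfield_of_type (rat_adjoin v)"
proof -
  interpret T: field "ring_of_type_algebra :: real ring" ..
  have uminus: "\<ominus>\<^bsub>ring_of_type_algebra\<^esub> a = - a" for a :: real
    by (rule T.minus_equality) (simp_all add: ring_of_type_algebra_def)
  have inv: "inv\<^bsub>ring_of_type_algebra\<^esub> a = inverse a" if "a \<noteq> 0" for a :: real
    using that by (intro T.comm_inv_char) (simp_all add: ring_of_type_algebra_def)
  have carrier: "carrier (rat_adjoin v) = generate_field ring_of_type_algebra {v}"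
    by (simp add: rat_adjoin_def)
  show ?thesis
  proof
    show "0 \<in> carrier (rat_adjoin v)"
      using T.zero_in_generate[of "{v}"] by (simp add: carrier ring_of_type_algebra_def)
    then show "inverse a \<in> carrier (rat_adjoin v)" if "a \<in> carrier (rat_adjoin v)" for a
      using generate_field.m_inv[of a ring_of_type_algebra "{v}"] that inv[of a]
      by (cases "a = 0") (simp_all add: carrier ring_of_type_algebra_def)
    show "1 \<in> carrier (rat_adjoin v)"
      using generate_field.one[of ring_of_type_algebra "{v}"]
      by (simp add: carrier ring_of_type_algebra_def)
    show "- a \<in> carrier (rat_adjoin v)" if "a \<in> carrier (rat_adjoin v)" for a
      using generate_field.a_inv[of a ring_of_type_algebra "{v}"] that
      by (simp add: carrier uminus)
    show "a + b \<in> carrier (rat_adjoin v)" "a * b \<in> carrier (rat_adjoin v)"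
      if "a \<in> carrier (rat_adjoin v)" "b \<in> carrier (rat_adjoin v)" for a b
      using generate_field.eng_add[of a ring_of_type_algebra "{v}" b]
        generate_field.eng_mult[of a ring_of_type_algebra "{v}" b] that
      by (simp_all add: carrier ring_of_type_algebra_def)
  qed
qed

lemma mem_rat_adjoin: "v \<in> carrier (rat_adjoin v)"
  by (simp add: rat_adjoin_def generate_field.incl)

lemma monoid_algebra_simps [simp]:
  "monoid.mult (monoid_algebra K) = (*)"
  "one (monoid_algebra K) = 1"
  "ring.zero (monoid_algebra K) = 0"
  "add (monoid_algebra K) = (+)"
  "module.smult (monoid_algebra K) = scale"
  by (simp_all add: monoid_algebra_def)

lemma carrier_monoid_algebra:
  "p \<in> carrier (monoid_algebra K) \<longleftrightarrow> (\<forall>m. Poly_Mapping.lookup p m \<in> carrier K)"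
  by (simp add: monoid_algebra_def)

context subfield_of_type
begin

abbreviation carrier_algebra :: "('m::monoid_add \<Rightarrow>\<^sub>0 'k) set" where
  "carrier_algebra \<equiv> carrier (monoid_algebra K)"

lemma monoid_algebra_induct [consumes 1, case_names zero add]:
  assumes "p \<in> carrier_algebra"
    and "P 0"
    and "\<And>m c p. \<lbrakk>c \<in> carrier K; p \<in> carrier_algebra; P p\<rbrakk> \<Longrightarrow> P (Poly_Mapping.single m c + p)"
  shows "P p"
  using assms unfolding carrier_monoid_algebra
  by (elim poly_mapping_induct_on[where S = "carrier K", rotated])
    (simp_all add: insert_absorb)

lemma zero_closed_algebra [simp]: "0 \<in> carrier_algebra"
  by (simp add: carrier_monoid_algebra)

lemma single_closed [simp]: "c \<in> carrier K \<Longrightarrow> Poly_Mapping.single m c \<in> carrier_algebra"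
  by (simp add: carrier_monoid_algebra lookup_single when_def)

lemma one_closed_algebra [simp]: "1 \<in> carrier_algebra"
  using single_closed[of 1 0] by (simp del: single_closed)

lemma add_closed_algebra [simp]:
  "\<lbrakk>p \<in> carrier_algebra; r \<in> carrier_algebra\<rbrakk> \<Longrightarrow> p + r \<in> carrier_algebra"
  by (simp add: carrier_monoid_algebra lookup_add)

lemma uminus_closed_algebra [simp]: "p \<in> carrier_algebra \<Longrightarrow> - p \<in> carrier_algebra"
  by (simp add: carrier_monoid_algebra)

lemma diff_closed_algebra [simp]:
  "\<lbrakk>p \<in> carrier_algebra; r \<in> carrier_algebra\<rbrakk> \<Longrightarrow> p - r \<in> carrier_algebra"
  by (simp add: carrier_monoid_algebra lookup_minus)

lemma scale_closed [simp]:
  "\<lbrakk>c \<in> carrier K; p \<in> carrier_algebra\<rbrakk> \<Longrightarrow> scale c p \<in> carrier_algebra"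
  by (simp add: carrier_monoid_algebra)

lemma linear_extension_closed:
  assumes "p \<in> carrier_algebra" "\<And>m. g m \<in> carrier_algebra"
  shows "linear_extension g p \<in> carrier_algebra"
  using assms by (induction p rule: monoid_algebra_induct) (simp_all add: linear_extension_add)

lemma mult_closed_algebra [simp]:
  assumes "p \<in> carrier_algebra" "r \<in> carrier_algebra"
  shows "p * r \<in> carrier_algebra"
  using assms(1)
proof (induction p rule: monoid_algebra_induct)
  case (add m c p)
  from assms(2) have "Poly_Mapping.single m c * r \<in> carrier_algebra"
    by (induction r rule: monoid_algebra_induct) (simp_all add: distrib_left mult_single add)
  with add show ?case by (simp add: distrib_right)
qed simp

lemma power_closed_algebra [simp]: "p \<in> carrier_algebra \<Longrightarrow> p ^ n \<in> carrier_algebra"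
  by (induction n) simp_all

sublocale monoid_algebra: ring "monoid_algebra K"
proof (rule ringI)
  show "abelian_group (monoid_algebra K)"
    by (rule abelian_groupI) (auto simp: add.assoc add.commute intro: bexI[of _ "- _"])
  show "Group.monoid (monoid_algebra K)"
    by (rule monoidI) (simp_all add: mult.assoc)
qed (simp_all add: distrib_left distrib_right)

lemma a_inv_monoid_algebra [simp]:
  "p \<in> carrier_algebra \<Longrightarrow> \<ominus>\<^bsub>monoid_algebra K\<^esub> p = - p"
  by (rule monoid_algebra.minus_equality) simp_all

lemma a_minus_monoid_algebra [simp]:
  "\<lbrakk>p \<in> carrier_algebra; r \<in> carrier_algebra\<rbrakk> \<Longrightarrow> p \<ominus>\<^bsub>monoid_algebra K\<^esub> r = p - r"
  by (simp add: a_minus_def)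

lemma free_gen_closed [simp]: "free_gen g \<in> carrier_algebra"
  by (simp add: free_gen_def)

lemma ideal_monoid_algebraI:
  assumes "\<And>p. p \<in> I \<Longrightarrow> p \<in> carrier_algebra" "0 \<in> I"
    and "\<And>p r. \<lbrakk>p \<in> I; r \<in> I\<rbrakk> \<Longrightarrow> p + r \<in> I"
    and "\<And>p r. \<lbrakk>p \<in> I; r \<in> carrier_algebra\<rbrakk> \<Longrightarrow> p * r \<in> I"
    and "\<And>p r. \<lbrakk>p \<in> I; r \<in> carrier_algebra\<rbrakk> \<Longrightarrow> r * p \<in> I"
  shows "ideal I (monoid_algebra K)"
proof (rule idealI)
  show "subgroup I (add_monoid (monoid_algebra K))"
  proof (rule group.subgroupI[OF monoid_algebra.a_group])
    fix p assume p: "p \<in> I"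
    then have "- p \<in> I"
      using assms(4)[of p "- 1"] by simp
    then show "inv\<^bsub>add_monoid (monoid_algebra K)\<^esub> p \<in> I"
      using p assms(1) by (subst a_inv_def[symmetric]) simp
  qed (use assms(1-3) in \<open>simp_all add: subset_iff ex_in_conv[symmetric] exI[of _ 0]\<close>)
qed (simp_all add: assms(4,5) monoid_algebra.ring_axioms)

lemma ideal_scale:
  assumes "ideal I (monoid_algebra K)" "p \<in> I" "c \<in> carrier K"
  shows "scale c p \<in> I"
proof -
  have "scale c 1 * p \<in> I"
    using ideal.I_l_closed[OF assms(1,2), of "scale c 1"] assms(3) by simp
  then show ?thesis by (simp add: scale_mult_left)
qed

end

section \<open>Presented algebras\<close>

locale presentation = subfield_of_type K for K :: "'k::field ring" +
  fixes R :: "('g word_monoid \<Rightarrow>\<^sub>0 'k) set"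
  assumes relations_closed: "R \<subseteq> carrier_algebra"
begin

abbreviation "F \<equiv> monoid_algebra K :: ('k, 'g word_monoid \<Rightarrow>\<^sub>0 'k) module"
abbreviation "J \<equiv> genideal F R"
abbreviation "A \<equiv> presented_algebra K R"
abbreviation proj where "proj \<equiv> (\<lambda>p. J +>\<^bsub>F\<^esub> p)"

sublocale J: ideal J F
  by (rule monoid_algebra.genideal_ideal) (rule relations_closed)

lemma presented_algebra_simps:
  "carrier A = proj ` carrier F"
  "monoid.mult A = monoid.mult (F Quot J)"
  "one A = proj 1"
  "ring.zero A = J"
  "add A = add (F Quot J)"
  by (auto simp: presented_algebra_def Let_def ring.defs module.defs free_algebra_def FactRing_def
      A_RCOSETS_defs a_r_coset_def)

lemma proj_mult [simp]:
  "\<lbrakk>p \<in> carrier F; r \<in> carrier F\<rbrakk> \<Longrightarrow> proj p \<otimes>\<^bsub>A\<^esub> proj r = proj (p * r)"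
  using J.rcoset_mult_add[of p r] by (simp add: presented_algebra_simps FactRing_def)

lemma proj_add [simp]:
  "\<lbrakk>p \<in> carrier F; r \<in> carrier F\<rbrakk> \<Longrightarrow> proj p \<oplus>\<^bsub>A\<^esub> proj r = proj (p + r)"
  using J.a_rcos_sum[of p r] by (simp add: presented_algebra_simps FactRing_def)

lemma proj_eq_iff:
  assumes "p \<in> carrier F" "r \<in> carrier F"
  shows "proj p = proj r \<longleftrightarrow> p - r \<in> J"
  using monoid_algebra.quotient_eq_iff_same_a_r_cos[OF J.ideal_axioms assms] assms by simp

lemma zero_eq_proj: "\<zero>\<^bsub>A\<^esub> = proj 0"
  using monoid_algebra.a_coset_add_zero[OF J.a_subset] by (simp add: presented_algebra_simps)

lemma proj_smult [simp]:
  assumes "p \<in> carrier F" "c \<in> carrier K"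
  shows "c \<odot>\<^bsub>A\<^esub> proj p = proj (scale c p)"
proof -
  have "c \<odot>\<^bsub>A\<^esub> proj p = (\<Union>a\<in>proj p. proj (scale c a))"
    by (simp add: presented_algebra_def Let_def ring.defs module.defs free_algebra_def)
  also have "proj (scale c a) = proj (scale c p)" if "a \<in> proj p" for a
  proof -
    have a: "a \<in> carrier F"
      using that assms(1) monoid_algebra.a_r_coset_subset_G[OF J.a_subset] by blast
    have "proj a = proj p"
      using monoid_algebra.a_repr_independence[OF that assms(1) J.a_subgroup] by simp
    then have "a - p \<in> J"
      using a assms(1) by (simp add: proj_eq_iff)
    then have "scale c (a - p) \<in> J"
      using ideal_scale J.ideal_axioms assms(2) by blast
    then show ?thesis
      using a assms by (simp add: proj_eq_iff scale_diff_right)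
  qed
  then have "(\<Union>a\<in>proj p. proj (scale c a)) = proj (scale c p)"
    using J.a_rcos_self[of p] assms(1) by blast
  finally show ?thesis .
qed

sublocale A: ring A
proof (rule ringI)
  note [simp] = presented_algebra_simps(1)
  show "abelian_group A"
  proof (rule abelian_groupI)
    show "\<zero>\<^bsub>A\<^esub> \<in> carrier A" by (auto simp: zero_eq_proj)
    show "\<exists>y\<in>carrier A. y \<oplus>\<^bsub>A\<^esub> x = \<zero>\<^bsub>A\<^esub>" if "x \<in> carrier A" for x
    proof -
      from that obtain p where "p \<in> carrier F" "x = proj p" by auto
      then show ?thesis
        by (intro bexI[of _ "proj (- p)"]) (simp_all add: zero_eq_proj)
    qed
  qed (auto simp: zero_eq_proj ac_simps)
  show "Group.monoid A"
    by (rule monoidI) (auto simp: presented_algebra_simps(3) mult.assoc)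
qed (auto simp: presented_algebra_simps(1) distrib_left distrib_right)

lemma proj_closed [simp]: "p \<in> carrier F \<Longrightarrow> proj p \<in> carrier A"
  by (simp add: presented_algebra_simps)

lemma carrier_presented_algebraE:
  assumes "a \<in> carrier A"
  obtains p where "p \<in> carrier F" "a = proj p"
  using assms by (auto simp: presented_algebra_simps)

lemma proj_uminus: "p \<in> carrier F \<Longrightarrow> \<ominus>\<^bsub>A\<^esub> proj p = proj (- p)"
  by (rule A.minus_equality) (simp_all add: zero_eq_proj)

lemma proj_diff:
  "\<lbrakk>p \<in> carrier F; r \<in> carrier F\<rbrakk> \<Longrightarrow> proj p \<ominus>\<^bsub>A\<^esub> proj r = proj (p - r)"
  by (simp add: a_minus_def proj_uminus)

lemma ideal_vimage_proj:
  assumes "ideal I A"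
  shows "ideal {p \<in> carrier F. proj p \<in> I} F"
proof -
  interpret I: ideal I A by fact
  show ?thesis
  proof (rule ideal_monoid_algebraI)
    fix p r assume "p \<in> {p \<in> carrier F. proj p \<in> I}" "r \<in> {p \<in> carrier F. proj p \<in> I}"
    then show "p + r \<in> {p \<in> carrier F. proj p \<in> I}"
      using I.a_closed[of "proj p" "proj r"] by simp
  next
    fix p r assume "p \<in> {p \<in> carrier F. proj p \<in> I}" "r \<in> carrier F"
    then show "p * r \<in> {p \<in> carrier F. proj p \<in> I}" "r * p \<in> {p \<in> carrier F. proj p \<in> I}"
      using I.I_l_closed[of "proj p" "proj r"] I.I_r_closed[of "proj p" "proj r"] by simp_all
  qed (use I.zero_closed in \<open>auto simp: zero_eq_proj\<close>)
qed

lemma ideal_is_submodule: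
  assumes "ideal I A"
  shows "submodule I K A"
proof -
  interpret I: ideal I A by fact
  show ?thesis
  proof (intro submodule.intro submodule_axioms.intro)
    show "subgroup I (add_monoid A)"
      by (rule I.a_subgroup)
    fix c a assume c: "c \<in> carrier K" and a: "a \<in> I"
    obtain p where p: "p \<in> carrier F" "a = proj p"
      using a I.a_Hcarr by (blast elim: carrier_presented_algebraE)
    have "proj (scale c 1) \<otimes>\<^bsub>A\<^esub> a \<in> I"
      using I.I_l_closed[OF a] c by simp
    then show "c \<odot>\<^bsub>A\<^esub> a \<in> I"
      using c p by (simp add: scale_mult_left)
  qed
qed

lemma genideal_commutator_space_le_iff:
  assumes "ideal I A"
  shows "genideal A (commutator_space K A) \<subseteq> I \<longleftrightarrow>
    (\<forall>p\<in>carrier F. \<forall>r\<in>carrier F. proj (p * r - r * p) \<in> I)"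
proof
  have comm: "proj (p * r - r * p) \<in> genideal A (commutator_space K A)"
    if "p \<in> carrier F" "r \<in> carrier F" for p r
  proof -
    have "proj p \<otimes>\<^bsub>A\<^esub> proj r \<ominus>\<^bsub>A\<^esub> proj r \<otimes>\<^bsub>A\<^esub> proj p
        \<in> {a \<otimes>\<^bsub>A\<^esub> b \<ominus>\<^bsub>A\<^esub> b \<otimes>\<^bsub>A\<^esub> a | a b. a \<in> carrier A \<and> b \<in> carrier A}"
      using that proj_closed by blast
    then have "proj (p * r - r * p)
        \<in> {a \<otimes>\<^bsub>A\<^esub> b \<ominus>\<^bsub>A\<^esub> b \<otimes>\<^bsub>A\<^esub> a | a b. a \<in> carrier A \<and> b \<in> carrier A}"
      using that by (simp add: proj_diff)
    then show ?thesis
      unfolding genideal_def commutator_space_def lin_span_def by blast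
  qed
  assume "genideal A (commutator_space K A) \<subseteq> I"
  with comm show "\<forall>p\<in>carrier F. \<forall>r\<in>carrier F. proj (p * r - r * p) \<in> I" by blast
next
  assume *: "\<forall>p\<in>carrier F. \<forall>r\<in>carrier F. proj (p * r - r * p) \<in> I"
  have "{a \<otimes>\<^bsub>A\<^esub> b \<ominus>\<^bsub>A\<^esub> b \<otimes>\<^bsub>A\<^esub> a | a b. a \<in> carrier A \<and> b \<in> carrier A} \<subseteq> I"
    using * by (auto elim!: carrier_presented_algebraE simp: proj_diff)
  then have "commutator_space K A \<subseteq> I"
    using ideal_is_submodule[OF assms] unfolding commutator_space_def lin_span_def by blast
  then show "genideal A (commutator_space K A) \<subseteq> I"
    using assms unfolding genideal_def by blast
qed

lemma ideal_genideal_commutator_space: "ideal (genideal A (commutator_space K A)) A"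
proof (rule A.genideal_ideal)
  have "ideal (carrier A) A" by (rule A.oneideal)
  then have "submodule (carrier A) K A" by (rule ideal_is_submodule)
  then show "commutator_space K A \<subseteq> carrier A"
    unfolding commutator_space_def lin_span_def by auto
qed

lemma presented_algebra_lift:
  assumes B: "ring B" and h: "h \<in> alg_hom K F B" and R: "\<And>r. r \<in> R \<Longrightarrow> h r = \<zero>\<^bsub>B\<^esub>"
  obtains \<phi> where "\<phi> \<in> alg_hom K A B" "\<And>p. p \<in> carrier F \<Longrightarrow> \<phi> (proj p) = h p"
proof -
  interpret B: ring B by fact
  interpret h: ring_hom_ring F B h
    using h by (intro ring_hom_ringI2[OF monoid_algebra.ring_axioms B]) (unfold alg_hom_def, blast)
  have "R \<subseteq> a_kernel F B h"
    using R relations_closed unfolding a_kernel_def' by blast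
  then have "J \<subseteq> a_kernel F B h"
    by (rule monoid_algebra.genideal_minimal[OF h.kernel_is_ideal])
  have h_eq: "h p = h r" if "proj p = proj r" "p \<in> carrier F" "r \<in> carrier F" for p r
  proof -
    have "p - r \<in> J" using that by (simp add: proj_eq_iff)
    then have "h (p - r) = \<zero>\<^bsub>B\<^esub>"
      using \<open>J \<subseteq> a_kernel F B h\<close> unfolding a_kernel_def' by blast
    moreover have "h ((p - r) + r) = h (p - r) \<oplus>\<^bsub>B\<^esub> h r"
      using h.hom_add[of "p - r" r] that by simp
    ultimately show ?thesis using that by simp
  qed
  define \<phi> where "\<phi> a = h (SOME p. p \<in> carrier F \<and> proj p = a)" for a
  have \<phi>: "\<phi> (proj p) = h p" if "p \<in> carrier F" for p
  proof -
    have "(SOME r. r \<in> carrier F \<and> proj r = proj p) \<in> carrier F \<and>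
        proj (SOME r. r \<in> carrier F \<and> proj r = proj p) = proj p"
      by (rule someI[of _ p]) (simp add: that)
    then show ?thesis
      unfolding \<phi>_def by (intro h_eq) (simp_all add: that)
  qed
  have "\<phi> \<in> ring_hom A B"
  proof (rule ring_hom_memI)
    show "\<phi> \<one>\<^bsub>A\<^esub> = \<one>\<^bsub>B\<^esub>"
      using h.hom_one by (simp add: presented_algebra_simps(3) \<phi>)
    fix a b assume "a \<in> carrier A" "b \<in> carrier A"
    then obtain p r where "p \<in> carrier F" "a = proj p" "r \<in> carrier F" "b = proj r"
      by (elim carrier_presented_algebraE)
    then show "\<phi> a \<in> carrier B" "\<phi> (a \<otimes>\<^bsub>A\<^esub> b) = \<phi> a \<otimes>\<^bsub>B\<^esub> \<phi> b"
      "\<phi> (a \<oplus>\<^bsub>A\<^esub> b) = \<phi> a \<oplus>\<^bsub>B\<^esub> \<phi> b"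
      using h.hom_mult[of p r] h.hom_add[of p r] h.hom_closed[of p] by (simp_all add: \<phi>)
  qed
  moreover have "\<phi> (c \<odot>\<^bsub>A\<^esub> a) = c \<odot>\<^bsub>B\<^esub> \<phi> a" if c: "c \<in> carrier K" and "a \<in> carrier A" for c a
  proof -
    from that(2) obtain p where p: "p \<in> carrier F" "a = proj p"
      by (rule carrier_presented_algebraE)
    then have "h (scale c p) = c \<odot>\<^bsub>B\<^esub> h p"
      using h c unfolding alg_hom_def by simp
    then show ?thesis
      using p c by (simp add: \<phi>)
  qed
  ultimately have "\<phi> \<in> alg_hom K A B"
    unfolding alg_hom_def by blast
  then show ?thesis
    using that \<phi> by blast
qed

lemma presented_gen_eq: "presented_gen K R g = proj (free_gen g)"
  by (simp add: presented_gen_def free_algebra_def)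

lemma presented_algebra_hom_unique:
  assumes B: "ring B" and "\<phi> \<in> alg_hom K A B" "\<psi> \<in> alg_hom K A B"
    and gens: "\<And>g. \<psi> (presented_gen K R g) = \<phi> (presented_gen K R g)"
    and a: "a \<in> carrier A"
  shows "\<psi> a = \<phi> a"
proof -
  interpret B: ring B by fact
  interpret \<phi>: ring_hom_ring A B \<phi>
    using assms by (intro ring_hom_ringI2[OF A.ring_axioms B]) (simp add: alg_hom_def)
  interpret \<psi>: ring_hom_ring A B \<psi>
    using assms by (intro ring_hom_ringI2[OF A.ring_axioms B]) (simp add: alg_hom_def)
  have words: "\<psi> (proj (Poly_Mapping.single (Word l) 1)) = \<phi> (proj (Poly_Mapping.single (Word l) 1))"
    for l
  proof (induction l)
    case Nil
    have "proj (Poly_Mapping.single (Word []) 1) = \<one>\<^bsub>A\<^esub>"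
      by (simp add: presented_algebra_simps(3) flip: zero_word_monoid_def)
    then show ?case by simp
  next
    case (Cons g l)
    have "Poly_Mapping.single (Word (g # l)) (1::'k) = free_gen g * Poly_Mapping.single (Word l) 1"
      by (simp add: free_gen_def mult_single plus_word_monoid_def)
    then have "proj (Poly_Mapping.single (Word (g # l)) 1) =
        proj (free_gen g) \<otimes>\<^bsub>A\<^esub> proj (Poly_Mapping.single (Word l) 1)"
      by simp
    then show ?case
      using Cons gens[of g] by (simp add: presented_gen_eq del: proj_mult)
  qed
  obtain p where "p \<in> carrier F" and p: "a = proj p"
    using a by (rule carrier_presented_algebraE)
  from this(1) have "\<psi> (proj p) = \<phi> (proj p)"
  proof (induction p rule: monoid_algebra_induct)
    case zero
    then show ?case by (simp flip: zero_eq_proj)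
  next
    case (add w c p)
    obtain l where l: "w = Word l" by (cases w)
    have "proj (Poly_Mapping.single w c + p) =
        c \<odot>\<^bsub>A\<^esub> proj (Poly_Mapping.single w 1) \<oplus>\<^bsub>A\<^esub> proj p"
      using add by (simp add: scale_single)
    moreover have "\<psi> (c \<odot>\<^bsub>A\<^esub> proj (Poly_Mapping.single w 1)) = c \<odot>\<^bsub>B\<^esub> \<psi> (proj (Poly_Mapping.single w 1))"
      "\<phi> (c \<odot>\<^bsub>A\<^esub> proj (Poly_Mapping.single w 1)) = c \<odot>\<^bsub>B\<^esub> \<phi> (proj (Poly_Mapping.single w 1))"
      using assms(2,3) add(1) proj_closed[OF single_closed[OF one_mem]]
      unfolding alg_hom_def by blast+
    moreover have "c \<odot>\<^bsub>A\<^esub> proj (Poly_Mapping.single w 1) \<in> carrier A"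
      using add by simp
    ultimately show ?case
      using add words[of l] l by (simp del: proj_smult proj_add)
  qed
  then show ?thesis by (simp add: p)
qed

end

section \<open>Evaluation of free algebras in monoid algebras\<close>

definition free_eval :: "('g \<Rightarrow> 'm::monoid_add \<Rightarrow>\<^sub>0 'k) \<Rightarrow> ('g word_monoid \<Rightarrow>\<^sub>0 'k) \<Rightarrow> ('m \<Rightarrow>\<^sub>0 'k::field)"
  where "free_eval f = linear_extension (\<lambda>w. prod_list (map f (letters w)))"

lemma free_eval_0 [simp]: "free_eval f 0 = 0"
  and free_eval_add [simp]: "free_eval f (p + r) = free_eval f p + free_eval f r"
  and free_eval_diff [simp]: "free_eval f (p - r) = free_eval f p - free_eval f r"
  and free_eval_scale [simp]: "free_eval f (scale c p) = scale c (free_eval f p)"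
  and free_eval_single:
    "free_eval f (Poly_Mapping.single w c) = scale c (prod_list (map f (letters w)))"
  by (simp_all add: free_eval_def linear_extension_add linear_extension_diff linear_extension_scale)

lemma free_eval_gen [simp]: "free_eval f (free_gen g) = f g"
  by (simp add: free_gen_def free_eval_single)

lemma letters_0 [simp]: "letters 0 = []"
  by (simp add: zero_word_monoid_def)

lemma free_eval_1 [simp]: "free_eval f 1 = 1"
  using free_eval_single[of f 0 1] by simp

lemma free_eval_mult [simp]: "free_eval f (p * r) = free_eval f p * free_eval f r"
  unfolding free_eval_def by (rule linear_extension_mult) (simp add: plus_word_monoid_def)

lemma free_eval_power [simp]: "free_eval f (p ^ n) = free_eval f p ^ n"
  by (induction n) simp_all

context subfield_of_type
begin

lemma free_eval_alg_hom:
  assumes "\<And>g. f g \<in> carrier_algebra"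
  shows "free_eval f \<in> alg_hom K (monoid_algebra K) (monoid_algebra K)"
proof -
  have "prod_list (map f l) \<in> carrier_algebra" for l
    using assms by (induction l) simp_all
  then have "free_eval f p \<in> carrier_algebra" if "p \<in> carrier_algebra" for p
    unfolding free_eval_def using that by (intro linear_extension_closed)
  then show ?thesis
    by (simp add: alg_hom_def ring_hom_def)
qed

end

section \<open>Congruence modulo an ideal\<close>

locale algebra_congruence = subfield_of_type K for K :: "'k::field ring" +
  fixes P :: "('m::monoid_add \<Rightarrow>\<^sub>0 'k) set"
  assumes ideal: "ideal P (monoid_algebra K)"
begin

definition congr (infix "\<approx>\<^sub>P" 50) where
  "a \<approx>\<^sub>P b \<longleftrightarrow> a \<in> carrier_algebra \<and> b \<in> carrier_algebra \<and> a - b \<in> P"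

lemma diff_in_ideal: "\<lbrakk>a \<in> P; b \<in> P\<rbrakk> \<Longrightarrow> a - b \<in> P"
proof -
  assume *: "a \<in> P" "b \<in> P"
  interpret P: ideal P "monoid_algebra K" by (rule ideal)
  have "- b \<in> P" using P.a_inv_closed[OF *(2)] *(2) by simp
  then show ?thesis using P.a_closed[OF *(1)] by fastforce
qed

lemma add_in_ideal: "\<lbrakk>a \<in> P; b \<in> P\<rbrakk> \<Longrightarrow> a + b \<in> P"
  using additive_subgroup.a_closed[OF ideal.axioms(1)[OF ideal]] by simp

lemma cong_closed: "a \<approx>\<^sub>P b \<Longrightarrow> a \<in> carrier_algebra" "a \<approx>\<^sub>P b \<Longrightarrow> b \<in> carrier_algebra"
  by (simp_all add: congr_def)

lemma cong_refl [simp]: "a \<in> carrier_algebra \<Longrightarrow> a \<approx>\<^sub>P a"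
  using additive_subgroup.zero_closed[OF ideal.axioms(1)[OF ideal]] by (simp add: congr_def)

lemma cong_sym: "a \<approx>\<^sub>P b \<Longrightarrow> b \<approx>\<^sub>P a"
  using diff_in_ideal[of 0 "a - b"] additive_subgroup.zero_closed[OF ideal.axioms(1)[OF ideal]]
  by (simp add: congr_def)

lemma cong_trans [trans]: "\<lbrakk>a \<approx>\<^sub>P b; b \<approx>\<^sub>P c\<rbrakk> \<Longrightarrow> a \<approx>\<^sub>P c"
  using add_in_ideal[of "a - b" "b - c"] by (simp add: congr_def)

lemma cong_add: "\<lbrakk>a \<approx>\<^sub>P b; a' \<approx>\<^sub>P b'\<rbrakk> \<Longrightarrow> a + a' \<approx>\<^sub>P b + b'"
  using add_in_ideal[of "a - b" "a' - b'"] by (simp add: congr_def algebra_simps)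

lemma cong_scale: "\<lbrakk>a \<approx>\<^sub>P b; c \<in> carrier K\<rbrakk> \<Longrightarrow> scale c a \<approx>\<^sub>P scale c b"
  using ideal_scale[OF ideal, of "a - b" c] by (simp add: congr_def scale_diff_right)

lemma cong_mult_left: "\<lbrakk>a \<approx>\<^sub>P b; c \<in> carrier_algebra\<rbrakk> \<Longrightarrow> c * a \<approx>\<^sub>P c * b"
  using ideal.I_l_closed[OF ideal, of "a - b" c] by (simp add: congr_def algebra_simps)

lemma cong_mult_right: "\<lbrakk>a \<approx>\<^sub>P b; c \<in> carrier_algebra\<rbrakk> \<Longrightarrow> a * c \<approx>\<^sub>P b * c"
  using ideal.I_r_closed[OF ideal, of "a - b" c] by (simp add: congr_def algebra_simps)

lemma cong_scale_cancel:
  assumes "scale c a \<approx>\<^sub>P scale c b" "c \<in> carrier K" "c \<noteq> 0"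
  shows "a \<approx>\<^sub>P b"
  using cong_scale[OF assms(1), of "inverse c"] assms(2,3) by (simp add: scale_scale)

lemma cong_scalar_if_relation:
  assumes rel: "m - scale s n + scale t 1 \<in> P" and "m \<approx>\<^sub>P n"
    and st: "s \<in> carrier K" "t \<in> carrier K" "s \<noteq> 1"
  shows "n \<approx>\<^sub>P scale (t / (s - 1)) 1"
proof -
  have "(m - n) - (m - scale s n + scale t 1) \<in> P"
    using diff_in_ideal[OF _ rel, of "m - n"] assms(2) by (simp add: congr_def)
  also have "(m - n) - (m - scale s n + scale t 1) = scale (s - 1) n - scale (s - 1) (scale (t / (s - 1)) 1)"
    using st(3) by (simp add: scale_diff_left scale_scale)
  finally have "scale (s - 1) n \<approx>\<^sub>P scale (s - 1) (scale (t / (s - 1)) 1)"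
    using assms by (simp add: congr_def del: scale_scale)
  then show ?thesis
    by (rule cong_scale_cancel) (use st in simp_all)
qed

end

section \<open>The commutative quotient of the algebra\<close>

definition laurent_gen :: "real \<Rightarrow> xy_gen \<Rightarrow> (int \<Rightarrow>\<^sub>0 real)" where
  "laurent_gen c g = (case g of GenX _ \<Rightarrow> scale c (laurent_power 1)
                              | GenY _ \<Rightarrow> scale c (laurent_power (- 1)))"

lemma laurent_gen_simps [simp]:
  "laurent_gen c (GenX i) = Poly_Mapping.single 1 c"
  "laurent_gen c (GenY i) = Poly_Mapping.single (- 1) c"
  by (simp_all add: laurent_gen_def laurent_power_def scale_single)

lemma free_eval_A_relations:
  assumes "1 < q" "c\<^sup>2 = q / (q - 1)\<^sup>2" "r \<in> A_relations q"
  shows "free_eval (laurent_gen c) r = 0"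
proof -
  have cubic: "e - (1 + inverse q) * e + inverse q * e = 0" for e :: real
    by (simp add: algebra_simps)
  have c_square: "c * c = q / (q - 1) / (q - 1)"
    using assms(2) by (simp add: power2_eq_square)
  have "c * c - q * (c * c) = - (c * c * (q - 1))"
    by (simp add: algebra_simps)
  then have quadratic_xy: "c * c - q * (c * c) + q / (q - 1) = 0"
    using assms(1) by (simp add: c_square)
  have "c * c - inverse q * (c * c) = c * c * (q - 1) / q"
    using assms(1) by (simp add: field_simps)
  then have quadratic_x_Suc_y: "c * c - inverse q * (c * c) - 1 / (q - 1) = 0"
    using assms(1) by (simp add: c_square)
  have scale_one: "scale t (1 :: int \<Rightarrow>\<^sub>0 real) = Poly_Mapping.single 0 t" for t
    using scale_single[of t 0 1] by simp
  show ?thesis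
    using assms(3) unfolding A_relations_def
    by (elim UnE CollectE exE conjE)
      (simp_all only: free_eval_add free_eval_diff free_eval_scale free_eval_mult free_eval_power
        free_eval_gen free_eval_1 laurent_gen_simps power2_eq_square mult_single mult.assoc
        scale_single scale_one cubic quadratic_xy quadratic_x_Suc_y arith_simps add_0_left add_0_right add.assoc
        add.left_inverse add.right_inverse diff_self single_zero
        flip: single_add single_diff)
qed

locale xy_congruence = algebra_congruence K P
  for K :: "real ring" and P :: "(xy_gen word_monoid \<Rightarrow>\<^sub>0 real) set" +
  fixes q c :: real
  assumes q: "1 < q" "q \<in> carrier K" and c: "c \<in> carrier K" "c\<^sup>2 = q / (q - 1)\<^sup>2"
    and relations: "A_relations q \<subseteq> P"
    and comm: "\<lbrakk>a \<in> carrier_algebra; b \<in> carrier_algebra\<rbrakk> \<Longrightarrow> a * b - b * a \<in> P"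
begin

lemma cong_comm: "\<lbrakk>a \<in> carrier_algebra; b \<in> carrier_algebra\<rbrakk> \<Longrightarrow> a * b \<approx>\<^sub>P b * a"
  by (simp add: congr_def comm)

lemma c_nonzero: "c \<noteq> 0"
  using c(2) q(1) by auto

lemma x_mult_y: "free_x i * free_y i \<approx>\<^sub>P scale (c\<^sup>2) 1"
proof -
  have "free_y i * free_x i - scale q (free_x i * free_y i) + scale (q / (q - 1)) 1 \<in> P"
    using relations unfolding A_relations_def by blast
  then have "free_x i * free_y i \<approx>\<^sub>P scale (q / (q - 1) / (q - 1)) 1"
    by (rule cong_scalar_if_relation) (use q in \<open>simp_all add: cong_comm\<close>)
  then show ?thesis unfolding c(2) by (simp add: power2_eq_square)
qed

lemma x_Suc_mult_y: "free_x (i + 1) * free_y i \<approx>\<^sub>P scale (c\<^sup>2) 1"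
proof -
  have "free_y i * free_x (i + 1) - scale (inverse q) (free_x (i + 1) * free_y i)
        - scale (1 / (q - 1)) 1 \<in> P"
    using relations unfolding A_relations_def by blast
  also have "free_y i * free_x (i + 1) - scale (inverse q) (free_x (i + 1) * free_y i)
        - scale (1 / (q - 1)) 1 = free_y i * free_x (i + 1)
        - scale (inverse q) (free_x (i + 1) * free_y i) + scale (- (1 / (q - 1))) 1"
    using scale_diff_left[of 0 "1 / (q - 1)" "1 :: xy_gen word_monoid \<Rightarrow>\<^sub>0 real"] by simp
  finally have "free_x (i + 1) * free_y i \<approx>\<^sub>P scale (- (1 / (q - 1)) / (inverse q - 1)) 1"
    by (rule cong_scalar_if_relation) (use q in \<open>simp_all add: cong_comm\<close>)
  also have "- (1 / (q - 1)) / (inverse q - 1) = c\<^sup>2"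
    using q(1) unfolding c(2) by (simp add: divide_simps power2_eq_square algebra_simps)
  finally show ?thesis .
qed

lemma x_Suc: "free_x (i + 1) \<approx>\<^sub>P free_x i"
proof (rule cong_scale_cancel[of "c\<^sup>2"])
  have "scale (c\<^sup>2) (free_x (i + 1)) = free_x (i + 1) * scale (c\<^sup>2) 1"
    by (simp add: scale_mult_right)
  also have "\<dots> \<approx>\<^sub>P free_x (i + 1) * (free_x i * free_y i)"
    by (intro cong_mult_left cong_sym[OF x_mult_y]) simp
  also have "\<dots> = (free_x (i + 1) * free_x i) * free_y i"
    by (simp add: mult.assoc)
  also have "\<dots> \<approx>\<^sub>P (free_x i * free_x (i + 1)) * free_y i"
    by (intro cong_mult_right cong_comm) simp_all
  also have "\<dots> = free_x i * (free_x (i + 1) * free_y i)"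
    by (simp add: mult.assoc)
  also have "\<dots> \<approx>\<^sub>P free_x i * scale (c\<^sup>2) 1"
    by (intro cong_mult_left x_Suc_mult_y) simp
  also have "\<dots> = scale (c\<^sup>2) (free_x i)"
    by (simp add: scale_mult_right)
  finally show "scale (c\<^sup>2) (free_x (i + 1)) \<approx>\<^sub>P scale (c\<^sup>2) (free_x i)" .
qed (use c(1) c_nonzero in simp_all)

lemma y_Suc: "free_y (i + 1) \<approx>\<^sub>P free_y i"
proof (rule cong_scale_cancel[of "c\<^sup>2"])
  have "scale (c\<^sup>2) (free_y (i + 1)) = free_y (i + 1) * scale (c\<^sup>2) 1"
    by (simp add: scale_mult_right)
  also have "\<dots> \<approx>\<^sub>P free_y (i + 1) * (free_x (i + 1) * free_y i)"
    by (intro cong_mult_left cong_sym[OF x_Suc_mult_y]) simp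
  also have "\<dots> = (free_y (i + 1) * free_x (i + 1)) * free_y i"
    by (simp add: mult.assoc)
  also have "\<dots> \<approx>\<^sub>P (free_x (i + 1) * free_y (i + 1)) * free_y i"
    by (intro cong_mult_right cong_comm) simp_all
  also have "\<dots> \<approx>\<^sub>P scale (c\<^sup>2) 1 * free_y i"
    by (intro cong_mult_right x_mult_y) simp
  also have "\<dots> = scale (c\<^sup>2) (free_y i)"
    by (simp add: scale_mult_left)
  finally show "scale (c\<^sup>2) (free_y (i + 1)) \<approx>\<^sub>P scale (c\<^sup>2) (free_y i)" .
qed (use c(1) c_nonzero in simp_all)

lemma cong_const_if_cong_Suc:
  fixes f :: "int \<Rightarrow> _"
  assumes "\<And>i. f (i + 1) \<approx>\<^sub>P f i"
  shows "f i \<approx>\<^sub>P f 0"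
proof (induction i rule: int_induct[where k = 0])
  case base
  show ?case using cong_closed[OF assms] by simp
next
  case (step1 i)
  then show ?case using assms cong_trans by blast
next
  case (step2 i)
  then show ?case using cong_sym[OF assms[of "i - 1"]] cong_sym cong_trans
    by (metis diff_add_cancel assms)
qed

lemma x_const: "free_x i \<approx>\<^sub>P free_x 0"
  by (rule cong_const_if_cong_Suc) (rule x_Suc)

lemma y_const: "free_y i \<approx>\<^sub>P free_y 0"
  by (rule cong_const_if_cong_Suc) (rule y_Suc)

text \<open>A lift of the Laurent monomial \<open>x\<^sup>n\<close>. It is multiplicative only modulo \<open>P\<close>; the factor
  \<open>1 / c\<close> undoes the scaling of the generators.\<close>

definition section_power :: "int \<Rightarrow> (xy_gen word_monoid \<Rightarrow>\<^sub>0 real)" where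
  "section_power n = (if 0 \<le> n then scale (1 / c) (free_x 0) ^ nat n
                               else scale (1 / c) (free_y 0) ^ nat (- n))"

lemma section_power_closed [simp]: "section_power n \<in> carrier_algebra"
  using c by (simp add: section_power_def)

lemma inverse_gens:
  shows "scale (1 / c) (free_x 0) * scale (1 / c) (free_y 0) \<approx>\<^sub>P 1"
    and "scale (1 / c) (free_y 0) * scale (1 / c) (free_x 0) \<approx>\<^sub>P 1"
proof -
  have "scale (1 / c * (1 / c)) (free_x 0 * free_y 0) \<approx>\<^sub>P scale (1 / c * (1 / c)) (scale (c\<^sup>2) 1)"
    using c by (intro cong_scale x_mult_y) simp_all
  then show 1: "scale (1 / c) (free_x 0) * scale (1 / c) (free_y 0) \<approx>\<^sub>P 1"
    using c_nonzero by (simp add: scale_scale scale_mult_left scale_mult_right power2_eq_square)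
  show "scale (1 / c) (free_y 0) * scale (1 / c) (free_x 0) \<approx>\<^sub>P 1"
    using c by (intro cong_trans[OF cong_comm 1]) simp_all
qed

lemma mult_section_power:
  shows "scale (1 / c) (free_x 0) * section_power n \<approx>\<^sub>P section_power (n + 1)" (is ?x)
    and "scale (1 / c) (free_y 0) * section_power n \<approx>\<^sub>P section_power (n - 1)" (is ?y)
proof -
  let ?a = "scale (1 / c) (free_x 0)" and ?b = "scale (1 / c) (free_y 0)"
  have closed: "?a \<in> carrier_algebra" "?b \<in> carrier_algebra" using c by simp_all
  have *: "a * (b * z) \<approx>\<^sub>P z"
    if "a * b \<approx>\<^sub>P 1" "z \<in> carrier_algebra" for a b z
    using cong_mult_right[OF that] by (simp add: mult.assoc)
  have pos: "section_power (int k) = ?a ^ k" for k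
    by (simp add: section_power_def)
  have neg_pow: "section_power (- int k) = ?b ^ k" for k
    by (cases k) (simp_all add: section_power_def nat_add_distrib)
  show ?x
  proof (cases n rule: int_cases)
    case (nonneg k)
    then show ?thesis using pos[of k] pos[of "Suc k"] closed by (simp add: add.commute)
  next
    case (neg k)
    then have "section_power n = ?b * section_power (n + 1)"
      using neg_pow[of k] neg_pow[of "Suc k"] by simp
    then show ?thesis using *[OF inverse_gens(1)] by simp
  qed
  show ?y
  proof (cases "0 < n")
    case True
    then obtain k where "n = int (Suc k)"
      using gr0_implies_Suc zero_less_imp_eq_int by metis
    then have "section_power n = ?a * section_power (n - 1)"
      using pos[of k] pos[of "Suc k"] by simp
    then show ?thesis using *[OF inverse_gens(2)] by simp
  next
    case False
    then obtain k where "n = - int k"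
      using nonpos_int_cases[of n] by (meson not_less)
    then have "n = - int k" "n - 1 = - int (Suc k)"
      by simp_all
    then have "section_power (n - 1) = ?b * section_power n"
      by (metis neg_pow power_Suc)
    then show ?thesis using closed by simp
  qed
qed

abbreviation "laurent_section \<equiv> linear_extension section_power"

lemma gen_mult_section_power:
  "free_gen g * section_power n \<approx>\<^sub>P laurent_section (laurent_gen c g * Poly_Mapping.single n 1)"
proof (cases g)
  case (GenX i)
  have "free_gen g * section_power n \<approx>\<^sub>P free_x 0 * section_power n"
    unfolding GenX by (intro cong_mult_right x_const) simp
  also have "\<dots> = scale c (scale (1 / c) (free_x 0) * section_power n)"
    using c_nonzero by (simp add: scale_mult_left scale_scale)
  also have "\<dots> \<approx>\<^sub>P scale c (section_power (n + 1))"
    using c by (intro cong_scale mult_section_power)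
  also have "\<dots> = laurent_section (laurent_gen c g * Poly_Mapping.single n 1)"
    by (simp add: GenX mult_single add.commute)
  finally show ?thesis .
next
  case (GenY i)
  have "free_gen g * section_power n \<approx>\<^sub>P free_y 0 * section_power n"
    unfolding GenY by (intro cong_mult_right y_const) simp
  also have "\<dots> = scale c (scale (1 / c) (free_y 0) * section_power n)"
    using c_nonzero by (simp add: scale_mult_left scale_scale)
  also have "\<dots> \<approx>\<^sub>P scale c (section_power (n - 1))"
    using c by (intro cong_scale mult_section_power)
  also have "\<dots> = laurent_section (laurent_gen c g * Poly_Mapping.single n 1)"
    by (simp add: GenY mult_single add.commute)
  finally show ?thesis .
qed

lemma gen_mult_section:
  assumes "p \<in> carrier_algebra"
  shows "free_gen g * laurent_section p \<approx>\<^sub>P laurent_section (laurent_gen c g * p)"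
  using assms
proof (induction p rule: monoid_algebra_induct)
  case (add n e p)
  have "scale e (free_gen g * section_power n)
      \<approx>\<^sub>P scale e (laurent_section (laurent_gen c g * Poly_Mapping.single n 1))"
    using add by (intro cong_scale gen_mult_section_power)
  also have "\<dots> = laurent_section (laurent_gen c g * Poly_Mapping.single n e)"
    by (simp flip: linear_extension_scale add: scale_mult_right[symmetric] scale_single)
  finally have "free_gen g * scale e (section_power n)
      \<approx>\<^sub>P laurent_section (laurent_gen c g * Poly_Mapping.single n e)"
    by (simp add: scale_mult_right)
  from cong_add[OF this add(3)] show ?case
    by (simp add: linear_extension_add distrib_left)
qed simp

lemma cong_section:
  assumes "p \<in> carrier_algebra"
  shows "p \<approx>\<^sub>P laurent_section (free_eval (laurent_gen c) p)"
  using assms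
proof (induction p rule: monoid_algebra_induct)
  case (add w e p)
  have gens: "laurent_gen c g \<in> carrier_algebra" for g
    using c by (cases g) simp_all
  have "Poly_Mapping.single (Word l) 1 \<approx>\<^sub>P laurent_section (prod_list (map (laurent_gen c) l))" for l
  proof (induction l)
    case Nil
    have "laurent_section 1 = section_power 0"
      using linear_extension_single[of section_power 0 1] by simp
    also have "section_power 0 = 1" by (simp add: section_power_def)
    finally show ?case by (simp flip: zero_word_monoid_def)
  next
    case (Cons g l)
    have "prod_list (map (laurent_gen c) l) \<in> carrier_algebra"
      using gens by (induction l) simp_all
    then have step: "free_gen g * laurent_section (prod_list (map (laurent_gen c) l))
        \<approx>\<^sub>P laurent_section (laurent_gen c g * prod_list (map (laurent_gen c) l))"
      by (rule gen_mult_section)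
    have "Poly_Mapping.single (Word (g # l)) 1 = free_gen g * Poly_Mapping.single (Word l) 1"
      by (simp add: free_gen_def mult_single plus_word_monoid_def)
    also have "\<dots> \<approx>\<^sub>P free_gen g * laurent_section (prod_list (map (laurent_gen c) l))"
      by (intro cong_mult_left Cons) simp
    also note step
    finally show ?case by simp
  qed
  from cong_scale[OF this[of "letters w"] add(1)]
  have "Poly_Mapping.single w e \<approx>\<^sub>P laurent_section (free_eval (laurent_gen c) (Poly_Mapping.single w e))"
    by (simp add: scale_single free_eval_single linear_extension_scale)
  from cong_add[OF this add(3)] show ?case
    by (simp add: linear_extension_add)
qed simp

lemma kernel_le_ideal:
  assumes "p \<in> carrier_algebra" "free_eval (laurent_gen c) p = 0"
  shows "p \<in> P"
  using cong_section[OF assms(1)] by (simp add: assms(2) congr_def)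

end

lemma A_relations_closed:
  assumes "subfield_of_type K" "q \<in> carrier K"
  shows "A_relations q \<subseteq> carrier (monoid_algebra K)"
proof -
  interpret subfield_of_type K by fact
  show ?thesis
    using assms(2) unfolding A_relations_def
    by (intro Un_least subsetI) (elim CollectE exE conjE; simp)+
qed

theorem lemma6p1:
  fixes q :: nat and v :: real
  assumes "primepow q" and "v = sqrt (real q)"
  shows
    "let K = rat_adjoin v;
         A = A_algebra q;
         L = laurent_algebra K;
         I = genideal A (commutator_space K A);
         assigns = (\<lambda>f. (\<forall>i. f (A_x q i) = (v / (v\<^sup>2 - 1)) \<odot>\<^bsub>L\<^esub> laurent_power 1) \<and>
                        (\<forall>i. f (A_y q i) = (v / (v\<^sup>2 - 1)) \<odot>\<^bsub>L\<^esub> laurent_power (-1)))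
     in \<exists>\<phi>\<in>alg_hom K A L.
          assigns \<phi> \<and>
          (\<forall>\<psi>\<in>alg_hom K A L. assigns \<psi> \<longrightarrow> (\<forall>a\<in>carrier A. \<psi> a = \<phi> a)) \<and>
          a_kernel A L \<phi> = I"
proof -
  define K where "K = rat_adjoin v"
  define R where "R = A_relations (real q)"
  define c where "c = v / (v\<^sup>2 - 1)"
  have q: "1 < real q"
    using primepow_gt_Suc_0[OF assms(1)] by simp
  have v2: "v\<^sup>2 = real q"
    using assms(2) by simp
  have c2: "c\<^sup>2 = real q / (real q - 1)\<^sup>2"
    by (simp add: c_def power_divide v2)
  have K_subfield: "subfield_of_type K"
    unfolding K_def by (rule subfield_of_type_rat_adjoin)
  interpret subfield_of_type K by (rule K_subfield)
  have v_mem: "v \<in> carrier K"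
    unfolding K_def by (rule mem_rat_adjoin)
  have q_mem: "real q \<in> carrier K"
    using power_mem[OF v_mem, of 2] by (simp add: v2)
  have c_mem: "c \<in> carrier K"
    using v_mem by (simp add: c_def)
  interpret presentation K R
    using K_subfield A_relations_closed[OF K_subfield q_mem]
    by (simp add: presentation_def presentation_axioms_def R_def)
  let ?L = "monoid_algebra K :: (real, int \<Rightarrow>\<^sub>0 real) module"
  let ?h = "free_eval (laurent_gen c)"
  let ?I = "genideal A (commutator_space K A)"
  have L: "ring ?L" by (rule monoid_algebra.ring_axioms)
  have gens: "laurent_gen c g \<in> carrier ?L" for g
    using c_mem by (cases g) simp_all
  have h: "?h \<in> alg_hom K F ?L"
    using gens by (rule free_eval_alg_hom)
  have "?h r = \<zero>\<^bsub>?L\<^esub>" if "r \<in> R" for r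
    using free_eval_A_relations[OF q c2] that by (simp add: R_def)
  from presented_algebra_lift[OF L h this] obtain \<phi>
    where \<phi>: "\<phi> \<in> alg_hom K A ?L" and \<phi>_proj: "\<And>p. p \<in> carrier F \<Longrightarrow> \<phi> (proj p) = ?h p"
    by blast
  have \<phi>_gen: "\<phi> (presented_gen K R g) = laurent_gen c g" for g
    by (simp add: presented_gen_eq \<phi>_proj)
  have unique: "\<psi> a = \<phi> a"
    if "\<psi> \<in> alg_hom K A ?L" "\<And>g. \<psi> (presented_gen K R g) = laurent_gen c g" "a \<in> carrier A" for \<psi> a
    by (rule presented_algebra_hom_unique[OF L \<phi> that(1) _ that(3)]) (simp add: that(2) \<phi>_gen)
  have "a_kernel A ?L \<phi> = ?I"
  proof
    have "\<phi> \<in> ring_hom A ?L"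
      using \<phi> unfolding alg_hom_def by blast
    then have ideal: "ideal (a_kernel A ?L \<phi>) A"
      by (intro ring_hom_ring.kernel_is_ideal ring_hom_ringI2[OF A.ring_axioms L])
    have "proj (p * r - r * p) \<in> a_kernel A ?L \<phi>" if "p \<in> carrier F" "r \<in> carrier F" for p r
    proof -
      have "\<phi> (proj (p * r - r * p)) = 0"
        using that by (simp add: \<phi>_proj mult.commute)
      then show ?thesis
        using that unfolding a_kernel_def' by simp
    qed
    then show "?I \<subseteq> a_kernel A ?L \<phi>"
      using genideal_commutator_space_le_iff[OF ideal] by blast
  next
    let ?P = "{p \<in> carrier F. proj p \<in> ?I}"
    have I: "ideal ?I A" by (rule ideal_genideal_commutator_space)
    then have P: "ideal ?P F" by (rule ideal_vimage_proj)
    have "R \<subseteq> ?P"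
    proof
      fix r assume r: "r \<in> R"
      then have r_closed: "r \<in> carrier F" using relations_closed by blast
      have "r \<in> J" using monoid_algebra.genideal_self[OF relations_closed] r by blast
      then have "proj r = \<zero>\<^bsub>A\<^esub>"
        using r_closed by (simp add: zero_eq_proj proj_eq_iff)
      then show "r \<in> ?P"
        using r_closed additive_subgroup.zero_closed[OF ideal.axioms(1)[OF I]] by simp
    qed
    moreover have "a * b - b * a \<in> ?P" if "a \<in> carrier F" "b \<in> carrier F" for a b
      using genideal_commutator_space_le_iff[OF I] that by simp
    ultimately interpret xy_congruence K ?P "real q" c
      using q q_mem c_mem c2 P K_subfield unfolding R_def
      by (intro xy_congruence.intro algebra_congruence.intro algebra_congruence_axioms.intro
          xy_congruence_axioms.intro)
    show "a_kernel A ?L \<phi> \<subseteq> ?I"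
    proof
      fix a assume a: "a \<in> a_kernel A ?L \<phi>"
      then obtain p where p: "p \<in> carrier F" "a = proj p"
        unfolding a_kernel_def' by (blast elim: carrier_presented_algebraE)
      then have "?h p = 0"
        using a by (simp add: a_kernel_def' \<phi>_proj)
      then show "a \<in> ?I"
        using kernel_le_ideal[OF p(1)] p(2) by simp
    qed
  qed
  moreover have "A_x q i = presented_gen K R (GenX i)" "A_y q i = presented_gen K R (GenY i)" for i
    by (simp_all add: A_x_def A_y_def K_def R_def assms(2))
  moreover have "A_algebra q = A"
    by (simp add: A_algebra_def K_def R_def assms(2))
  moreover have "laurent_gen c (GenX i) = (v / (v\<^sup>2 - 1)) \<odot>\<^bsub>?L\<^esub> laurent_power 1"
    "laurent_gen c (GenY i) = (v / (v\<^sup>2 - 1)) \<odot>\<^bsub>?L\<^esub> laurent_power (- 1)" for i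
    by (simp_all add: laurent_power_def scale_single c_def)
  ultimately show ?thesis
    unfolding Let_def laurent_algebra_def K_def[symmetric]
    using \<phi> \<phi>_gen unique by (intro bexI[of _ \<phi>]) (metis xy_gen.exhaust)+
qed

end
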